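(* Let $n\ge1$ and $A\in M_n(\mathbb{C})$. The eigenvectors of the orbital multiplication operator $H_A:W\to W$ are the characters $$\chi_k:\mathbb{Z}/n\mathbb{Z}\to\mathbb{C},\qquad \chi_k(r)=\omega^{kr},\qquad k\in\mathbb{Z}/n\mathbb{Z},$$ with corresponding eigenvalues exactly $G_k(A)$: the $\chi_k$ form a basis of $W$ and $H_A\chi_k=G_k(A)\chi_k$ for every $k$. In particular, $H_A$ is diagonalizable and, as a matrix in the standard coordinates of $W\cong\mathbb{C}^n$, $$H_A=F_n\,\mathrm{diag}(G_0(A),G_1(A),\dots,G_{n-1}(A))\,F_n^{-1},$$ where $F_n$ is the DFT matrix with $(k,r)$ entry $\frac{1}{\sqrt n}\omega^{kr}$, $0\le k,r\le n-1$.
   Context: Let $\omega=e^{2\pi i/n}$, let $S_n$ be the symmetric group on $\{1,\dots,n\}$ with composition $(\sigma\circ\tau)(i)=\sigma(\tau(i))$, let $\varepsilon(\sigma)$ be the sign of $\sigma$, and let $\rho=(1\,2\,\cdots\,n)$ be the cycle $\rho(i)=i+1$ for $i<n$, $\rho(n)=1$. Each orbit $\{\sigma\circ\rho^r: r\in\mathbb{Z}/n\mathbb{Z}\}$ contains exactly one permutation $\sigma^*$ with $\sigma^*(1)=1$. The orbital phase $\phi:S_n\to\mathbb{Z}/n\mathbb{Z}$ is the unique function such that $\phi(\sigma^*\circ\rho^r)=r$ for every $\sigma^*\in S_n$ with $\sigma^*(1)=1$ and every $r$. For $A=(a_{ij})\in M_n(\mathbb{C})$ put $m_\sigma(A)=\varepsilon(\sigma)\prod_{i=1}^n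 a_{i,\sigma(i)}$, $\Lambda_r(A)=\sum_{\sigma:\phi(\sigma)=r}m_\sigma(A)$ for $r\in\mathbb{Z}/n\mathbb{Z}$, and $G_k(A)=\sum_{r=0}^{n-1}\Lambda_r(A)\omega^{kr}$. $W=\{g:\mathbb{Z}/n\mathbb{Z}\to\mathbb{C}\}\cong\mathbb{C}^n$ with coordinates indexed by $r\in\{0,\dots,n-1\}$, and the orbital multiplication operator is $(H_Ag)(r)=\sum_{s\in\mathbb{Z}/n\mathbb{Z}}\Lambda_s(A)\,g(r+s)$, with $r+s$ taken modulo $n$. *)

theory Defs
  imports
    Complex_Main
    "HOL-Combinatorics.Permutations"
    "Jordan_Normal_Form.VS_Connect"
begin

text \<open>Conventions: \<open>S\<^sub>n\<close> is the set of \<open>\<sigma> :: nat \<Rightarrow> nat\<close> with \<open>\<sigma> permutes {1..n}\<close>, and composition is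
  \<open>\<circ>\<close>. Residues modulo \<open>n\<close> are represented by the natural numbers below \<open>n\<close>, and a function on
  \<open>\<int>/n\<int>\<close> by the vector in \<open>carrier_vec n\<close> of its values at \<open>0, \<dots>, n - 1\<close>. Library matrices are indexed
  from 0, so the mathematical entry \<open>a\<^sub>i\<^sub>j\<close> with \<open>1 \<le> i, j \<le> n\<close> is \<open>A $$ (i - 1, j - 1)\<close>.\<close>

definition root_unity :: "nat \<Rightarrow> complex" where
  "root_unity n = exp (2 * complex_of_real pi * \<i> / of_nat n)"

definition rho :: "nat \<Rightarrow> nat \<Rightarrow> nat" where
  "rho n i = (if 1 \<le> i \<and> i < n then i + 1 else if i = n then 1 else i)"

text \<open>The iterate \<open>rho n ^^ r\<close> is the power \<open>\<rho>\<^sup>r\<close>. The description below determines the phase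
  uniquely, see \<open>orbital_phase_ex1\<close> and \<open>orbital_phase_eq\<close>.\<close>

definition orbital_phase :: "nat \<Rightarrow> (nat \<Rightarrow> nat) \<Rightarrow> nat" where
  "orbital_phase n \<sigma> =
     (THE r. r < n \<and> (\<exists>\<tau>. \<tau> permutes {1..n} \<and> \<tau> 1 = 1 \<and> \<sigma> = \<tau> \<circ> (rho n ^^ r)))"

definition signed_monomial :: "nat \<Rightarrow> complex mat \<Rightarrow> (nat \<Rightarrow> nat) \<Rightarrow> complex" where
  "signed_monomial n A \<sigma> = of_int (sign \<sigma>) * (\<Prod>i = 1..n. A $$ (i - 1, \<sigma> i - 1))"

definition Lambda :: "nat \<Rightarrow> complex mat \<Rightarrow> nat \<Rightarrow> complex" where
  "Lambda n A r =
     (\<Sum>\<sigma> | \<sigma> permutes {1..n} \<and> orbital_phase n \<sigma> = r. signed_monomial n A \<sigma>)"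

definition G :: "nat \<Rightarrow> complex mat \<Rightarrow> nat \<Rightarrow> complex" where
  "G n A k = (\<Sum>r = 0..<n. Lambda n A r * root_unity n ^ (k * r))"

definition orbital_op :: "nat \<Rightarrow> complex mat \<Rightarrow> complex vec \<Rightarrow> complex vec" where
  "orbital_op n A g = vec n (\<lambda>r. \<Sum>s = 0..<n. Lambda n A s * g $ ((r + s) mod n))"

definition character :: "nat \<Rightarrow> nat \<Rightarrow> complex vec" where
  "character n k = vec n (\<lambda>r. root_unity n ^ (k * r))"

definition dft_mat :: "nat \<Rightarrow> complex mat" where
  "dft_mat n = mat n n (\<lambda>(k, r). 1 / complex_of_real (sqrt (real n)) * root_unity n ^ (k * r))"

definition is_basis :: "nat \<Rightarrow> complex vec set \<Rightarrow> bool" where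
  "is_basis n S \<longleftrightarrow> vectorspace.basis class_ring (module_vec TYPE(complex) n) S"

definition op_eigenvector :: "nat \<Rightarrow> (complex vec \<Rightarrow> complex vec) \<Rightarrow> complex vec \<Rightarrow> complex \<Rightarrow> bool" where
  "op_eigenvector n T v c \<longleftrightarrow> v \<in> carrier_vec n \<and> v \<noteq> 0\<^sub>v n \<and> T v = c \<cdot>\<^sub>v v"

definition op_diagonalizable :: "nat \<Rightarrow> (complex vec \<Rightarrow> complex vec) \<Rightarrow> bool" where
  "op_diagonalizable n T \<longleftrightarrow> (\<exists>S. is_basis n S \<and> (\<forall>v\<in>S. \<exists>c. op_eigenvector n T v c))"

text \<open>The matrix of an operator in the standard coordinates: column \<open>j\<close> is the image of the
  \<open>j\<close>-th standard basis vector.\<close>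

definition std_matrix :: "nat \<Rightarrow> (complex vec \<Rightarrow> complex vec) \<Rightarrow> complex mat" where
  "std_matrix n T = mat n n (\<lambda>(i, j). T (unit_vec n j) $ i)"

lemma rho_pow:
  assumes "1 \<le> i" "i \<le> n"
  shows "(rho n ^^ r) i = (i - 1 + r) mod n + 1"
proof (induction r)
  case 0
  then show ?case using assms by simp
next
  case (Suc r)
  have "(i - 1 + r) mod n < n" using assms by simp
  then show ?case using Suc by (auto simp: rho_def mod_Suc)
qed

lemma rho_permutes:
  assumes "n \<ge> 1"
  shows "rho n permutes {1..n}"
proof (rule bij_imp_permutes)
  have inj: "inj_on (rho n) {1..n}"
    by (auto simp: inj_on_def rho_def split: if_splits)
  have "rho n ` {1..n} \<subseteq> {1..n}" by (auto simp: rho_def)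
  then show "bij_betw (rho n) {1..n} {1..n}"
    using inj by (simp add: bij_betw_def endo_inj_surj)
next
  fix i assume "i \<notin> {1..n}"
  then show "rho n i = i" using assms by (auto simp: rho_def)
qed

lemma rho_pow_permutes:
  assumes "n \<ge> 1"
  shows "(rho n ^^ r) permutes {1..n}"
proof (induction r)
  case 0
  show ?case by (simp only: funpow_0 funpow.simps permutes_id)
next
  case (Suc r)
  then show ?case
    using permutes_compose[OF Suc rho_permutes[OF assms]] by (simp only: funpow.simps)
qed

lemma rho_pow_mod:
  assumes "n \<ge> 1"
  shows "rho n ^^ r = rho n ^^ (r mod n)"
proof
  fix i
  show "(rho n ^^ r) i = (rho n ^^ (r mod n)) i"
  proof (cases "i \<in> {1..n}")
    case True
    then have i: "1 \<le> i" "i \<le> n" by auto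
    show ?thesis unfolding rho_pow[OF i] mod_add_right_eq ..
  next
    case False
    then show ?thesis
      using rho_pow_permutes[OF assms] by (metis permutes_not_in)
  qed
qed

lemma rho_phase_unique:
  assumes n: "n \<ge> 1" and "r < n" "s < n"
    and t: "\<tau> 1 = 1" and t': "\<tau>' permutes {1..n}" "\<tau>' 1 = 1"
    and eq: "\<tau> \<circ> (rho n ^^ r) = \<tau>' \<circ> (rho n ^^ s)"
  shows "r = s"
proof -
  define j where "j = (n - r) mod n + 1"
  have j: "1 \<le> j" "j \<le> n" "j - 1 = (n - r) mod n"
    using n by (auto simp: j_def Suc_le_eq)
  have "(j - 1 + r) mod n = 0"
    unfolding j(3) mod_add_left_eq using \<open>r < n\<close> by simp
  then have "(\<tau> \<circ> (rho n ^^ r)) j = 1"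
    using t by (simp only: comp_apply rho_pow[OF j(1,2)] add_0)
  then have "\<tau>' ((rho n ^^ s) j) = \<tau>' 1" using eq t' by simp
  then have "(rho n ^^ s) j = 1"
    using permutes_inj[OF t'(1)] by (simp add: inj_eq)
  then have "(j - 1 + s) mod n = 0" unfolding rho_pow[OF j(1,2)] by linarith
  then have "((n - r) + s) mod n = 0" unfolding j(3) mod_add_left_eq .
  then obtain q where q: "n - r + s = n * q" by (auto simp: mod_eq_0_iff_dvd elim: dvdE)
  then have "n * q < n * 2" "0 < n * q" using assms(2,3) by linarith+
  then have "q < 2" "0 < q" by simp_all
  then have "q = 1" by linarith
  then show ?thesis using q assms(2,3) by simp
qed

lemma orbital_phase_eq:
  assumes "n \<ge> 1" "\<tau> permutes {1..n}" "\<tau> 1 = 1"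
  shows "orbital_phase n (\<tau> \<circ> (rho n ^^ r)) = r mod n"
  unfolding orbital_phase_def
proof (rule the_equality)
  show "r mod n < n \<and> (\<exists>\<tau>'. \<tau>' permutes {1..n} \<and> \<tau>' 1 = 1 \<and>
      \<tau> \<circ> (rho n ^^ r) = \<tau>' \<circ> (rho n ^^ (r mod n)))"
    using assms rho_pow_mod[OF assms(1), of r] by auto
next
  fix s
  assume "s < n \<and> (\<exists>\<tau>'. \<tau>' permutes {1..n} \<and> \<tau>' 1 = 1 \<and>
      \<tau> \<circ> (rho n ^^ r) = \<tau>' \<circ> (rho n ^^ s))"
  then show "s = r mod n"
    using assms rho_pow_mod[OF assms(1), of r] rho_phase_unique[OF assms(1), of "r mod n" s \<tau>]
    by auto
qed

lemma orbital_phase_ex1: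
  assumes n: "n \<ge> 1" and s: "\<sigma> permutes {1..n}"
  shows "\<exists>!r. r < n \<and> (\<exists>\<tau>. \<tau> permutes {1..n} \<and> \<tau> 1 = 1 \<and> \<sigma> = \<tau> \<circ> (rho n ^^ r))"
proof -
  obtain j where j: "j \<in> {1..n}" "\<sigma> j = 1"
    using permutes_image[OF s] n by (metis atLeastAtMost_iff imageE order_refl)
  define \<tau> where "\<tau> = \<sigma> \<circ> (rho n ^^ (j - 1))"
  define r where "r = (n - (j - 1)) mod n"
  have t: "\<tau> permutes {1..n}"
    unfolding \<tau>_def by (intro permutes_compose rho_pow_permutes n s)
  have "(rho n ^^ (j - 1)) 1 = (j - 1) mod n + 1" using n by (simp add: rho_pow)
  then have t1: "\<tau> 1 = 1" using j by (auto simp: \<tau>_def)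
  have "\<tau> \<circ> (rho n ^^ r) = \<tau> \<circ> (rho n ^^ (n - (j - 1)))"
    unfolding r_def using rho_pow_mod[OF n] by metis
  also have "\<dots> = \<sigma> \<circ> (rho n ^^ ((j - 1) + (n - (j - 1))))"
    unfolding \<tau>_def funpow_add by (simp add: comp_assoc)
  also have "(j - 1) + (n - (j - 1)) = n" using j by auto
  also have "rho n ^^ n = id" using rho_pow_mod[OF n, of n] by simp
  finally have "\<sigma> = \<tau> \<circ> (rho n ^^ r)" by (simp only: comp_id)
  moreover have "r < n" using n by (simp add: r_def)
  ultimately show ?thesis
    using t t1 rho_phase_unique[OF n] by (intro ex1I[of _ r]) blast+
qed

lemma std_matrix_orbital_op:
  assumes "g \<in> carrier_vec n"
  shows "orbital_op n A g = std_matrix n (orbital_op n A) *\<^sub>v g"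
proof (rule eq_vecI)
  show "dim_vec (orbital_op n A g) = dim_vec (std_matrix n (orbital_op n A) *\<^sub>v g)"
    by (simp add: orbital_op_def std_matrix_def)
next
  fix r assume "r < dim_vec (std_matrix n (orbital_op n A) *\<^sub>v g)"
  then have r: "r < n" by (simp add: std_matrix_def)
  have "(std_matrix n (orbital_op n A) *\<^sub>v g) $ r =
      (\<Sum>j = 0..<n. (\<Sum>s = 0..<n. Lambda n A s * (unit_vec n j $ ((r + s) mod n))) * g $ j)"
    using r assms by (simp add: std_matrix_def scalar_prod_def orbital_op_def)
  also have "\<dots> = (\<Sum>s = 0..<n. \<Sum>j = 0..<n. Lambda n A s * (unit_vec n j $ ((r + s) mod n)) * g $ j)"
    by (subst sum.swap) (simp add: sum_distrib_right)
  also have "\<dots> = (\<Sum>s = 0..<n. \<Sum>j = 0..<n.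
      if j = (r + s) mod n then Lambda n A s * g $ ((r + s) mod n) else 0)"
    using r by (intro sum.cong refl) (auto simp: unit_vec_def)
  also have "\<dots> = (\<Sum>s = 0..<n. Lambda n A s * g $ ((r + s) mod n))"
    using r by (intro sum.cong refl) (simp add: sum.delta')
  finally show "orbital_op n A g $ r = (std_matrix n (orbital_op n A) *\<^sub>v g) $ r"
    using r by (simp add: orbital_op_def)
qed

end

theory Submission
  imports Defs "Jordan_Normal_Form.DL_Rank"
begin

text \<open>The operator \<open>orbital_op n A\<close> is a combination of the cyclic shifts \<open>g(r) \<mapsto> g(r + s)\<close>, weighted by the
  coefficients \<open>Lambda n A s\<close>. A character of \<open>\<int>/n\<int>\<close> turns each shift into multiplication by a
  scalar, \<open>\<chi>\<^sub>k(r + s) = \<omega>\<^bsup>ks\<^esup> \<chi>\<^sub>k(r)\<close>, so it is a common eigenvector of all shifts, and summing the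
  scalars against the weights gives the discrete Fourier transform \<open>G n A k\<close> as eigenvalue
  (\<open>orbital_op_character\<close>).

  The rest is that the characters are enough eigenvectors. Since \<open>\<omega>\<close> is a primitive \<open>n\<close>-th root of
  unity, a geometric sum gives their orthogonality (\<open>root_unity_orthogonality\<close>), which exhibits an
  explicit inverse of the Fourier matrix (\<open>dft_mat_inverse\<close>). Invertibility makes the
  characters, which are the rescaled columns of that matrix, a basis, and turns the eigenvector
  equations \<open>H F = F D\<close> into \<open>H = F D F\<^sup>-\<^sup>1\<close>. From that factorization no scalar outside the
  diagonal of \<open>D\<close> can be an eigenvalue.\<close>

section \<open>Orthogonality of the characters\<close>

lemma root_unity_power:
  "root_unity n ^ k = cis (2 * pi * real k / real n)"
proof -
  have "root_unity n = cis (2 * pi / real n)"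
    by (simp add: root_unity_def cis_conv_exp mult_ac)
  then show ?thesis by (simp add: DeMoivre mult_ac)
qed

lemma root_unity_nonzero [simp]: "root_unity n \<noteq> 0"
  by (simp add: root_unity_def)

lemma root_unity_power_n: "n \<ge> 1 \<Longrightarrow> root_unity n ^ n = 1"
  by (simp add: root_unity_power)

lemma root_unity_power_mod:
  assumes "n \<ge> 1"
  shows "root_unity n ^ (k * (j mod n)) = root_unity n ^ (k * j)"
proof -
  have "root_unity n ^ (k * j) = root_unity n ^ (k * (j mod n) + n * (k * (j div n)))"
    by (metis mod_mult_div_eq distrib_left mult.left_commute)
  then show ?thesis
    using root_unity_power_n[OF assms] by (simp add: power_add power_mult)
qed

lemma root_unity_power_inj:
  assumes "n \<ge> 1"
  shows "inj_on (\<lambda>k. root_unity n ^ k) {..<n}"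
  using bij_betw_roots_unity[of n] assms
  by (simp add: bij_betw_def root_unity_power)

text \<open>For \<open>k \<noteq> l\<close> the terms form a geometric progression whose ratio \<open>\<omega>\<^bsup>k-l\<^esup>\<close> differs from 1 but has
  \<open>n\<close>-th power 1.\<close>

lemma root_unity_orthogonality:
  assumes "n \<ge> 1" and k: "k < n" and l: "l < n"
  shows "(\<Sum>j = 0..<n. root_unity n ^ (k * j) * inverse (root_unity n) ^ (j * l))
    = (if k = l then of_nat n else 0)"
proof -
  define z where "z = root_unity n ^ k * inverse (root_unity n) ^ l"
  have term_eq: "root_unity n ^ (k * j) * inverse (root_unity n) ^ (j * l) = z ^ j" for j
    by (simp add: z_def power_mult_distrib power_mult mult.commute[of j l])
  show ?thesis
  proof (cases "k = l")
    case True
    then have "z = 1" by (simp add: z_def field_simps)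
    then show ?thesis unfolding term_eq using True by simp
  next
    case False
    have "z \<noteq> 1"
    proof
      assume "z = 1"
      then have "root_unity n ^ k = root_unity n ^ l" by (simp add: z_def field_simps)
      then show False
        using root_unity_power_inj[OF assms(1)] k l False by (auto dest: inj_onD)
    qed
    moreover have "z ^ n = 1"
    proof -
      have "z ^ n = (root_unity n ^ n) ^ k * inverse ((root_unity n ^ n) ^ l)"
        by (simp add: z_def power_mult_distrib power_inverse flip: power_mult)
          (simp add: mult.commute)
      then show ?thesis using root_unity_power_n[OF assms(1)] by simp
    qed
    ultimately have "(\<Sum>j<n. z ^ j) = 0" by (simp add: geometric_sum)
    then show ?thesis unfolding term_eq using False by (simp add: atLeast0LessThan)
  qed
qed

definition dft_inv_mat :: "nat \<Rightarrow> complex mat" where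
  "dft_inv_mat n =
     mat n n (\<lambda>(k, r). 1 / complex_of_real (sqrt (real n)) * inverse (root_unity n) ^ (k * r))"

lemma dft_mat_carrier [simp]: "dft_mat n \<in> carrier_mat n n"
  by (simp add: dft_mat_def)

lemma dft_inv_mat_carrier [simp]: "dft_inv_mat n \<in> carrier_mat n n"
  by (simp add: dft_inv_mat_def)

lemma sqrt_n_square:
  "complex_of_real (sqrt (real n)) * complex_of_real (sqrt (real n)) = of_nat n"
  by (simp flip: of_real_mult)

lemma dft_mat_inverse:
  assumes "n \<ge> 1"
  shows "dft_mat n * dft_inv_mat n = 1\<^sub>m n" and "dft_inv_mat n * dft_mat n = 1\<^sub>m n"
proof -
  show *: "dft_mat n * dft_inv_mat n = 1\<^sub>m n"
  proof (rule eq_matI)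
    fix k l assume "k < dim_row (1\<^sub>m n :: complex mat)" "l < dim_col (1\<^sub>m n :: complex mat)"
    then have k: "k < n" and l: "l < n" by auto
    let ?c = "1 / complex_of_real (sqrt (real n))"
    have "(dft_mat n * dft_inv_mat n) $$ (k, l)
        = (\<Sum>j = 0..<n. ?c * ?c * (root_unity n ^ (k * j) * inverse (root_unity n) ^ (j * l)))"
      using k l by (simp add: dft_mat_def dft_inv_mat_def scalar_prod_def mult_ac)
    also have "\<dots> = ?c * ?c * (if k = l then of_nat n else 0)"
      by (simp only: root_unity_orthogonality[OF assms k l] flip: sum_distrib_left)
    also have "?c * ?c = 1 / of_nat n" by (simp add: sqrt_n_square)
    finally show "(dft_mat n * dft_inv_mat n) $$ (k, l) = 1\<^sub>m n $$ (k, l)"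
      using assms k l by simp
  qed (simp_all add: dft_mat_def dft_inv_mat_def)
  show "dft_inv_mat n * dft_mat n = 1\<^sub>m n"
    by (rule mat_mult_left_right_inverse[OF _ _ *]) simp_all
qed

section \<open>Bases and eigenvalues from an invertible matrix\<close>

text \<open>A left inverse sends the columns to the unit vectors, so they are \<open>n\<close> different vectors, and it
  leaves no nonzero vector in the kernel, so they are linearly independent; their number then equals
  the dimension.\<close>

lemma cols_basis_of_left_inverse:
  assumes P: "P \<in> carrier_mat n n" and Q: "Q \<in> carrier_mat n n" and QP: "Q * P = 1\<^sub>m n"
  shows "distinct (cols P)" and "is_basis n (set (cols P))"
proof -
  have Q_col: "Q *\<^sub>v col P i = unit_vec n i" if "i < n" for i
    using col_mult2[OF Q P that] QP that by simp
  show dist: "distinct (cols P)"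
    unfolding distinct_conv_nth
  proof (intro allI impI notI)
    fix i j assume "i < length (cols P)" "j < length (cols P)" "i \<noteq> j" "cols P ! i = cols P ! j"
    then have ij: "i < n" "j < n" "i \<noteq> j" "col P i = col P j" using P by auto
    then have "(unit_vec n i :: complex vec) = unit_vec n j" using Q_col by metis
    then show False using ij by (simp add: unit_vec_eq)
  qed
  interpret vec_space "TYPE(complex)" n .
  have sub: "set (cols P) \<subseteq> carrier_vec n" using P cols_dim[of P] by auto
  have indpt: "lin_indpt (set (cols P))"
  proof
    assume "lin_dep (set (cols P))"
    then obtain v where v: "v \<in> carrier_vec n" "v \<noteq> 0\<^sub>v n" "P *\<^sub>v v = 0\<^sub>v n"
      using lin_depE[OF P _ dist] by blast
    have "v = (Q * P) *\<^sub>v v" using v QP by simp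
    also have "\<dots> = Q *\<^sub>v (P *\<^sub>v v)" using P Q v by simp
    also have "\<dots> = 0\<^sub>v n"
      unfolding v(3) using Q by (intro eq_vecI) simp_all
    finally show False using v by simp
  qed
  have "card (set (cols P)) = n" using dist P by (simp add: distinct_card)
  then have "basis (set (cols P))"
    using indpt sub by (intro dim_li_is_basis) (simp_all add: dim_is_n)
  then show "is_basis n (set (cols P))" by (simp add: is_basis_def)
qed

text \<open>In the coordinates \<open>w = Q v\<close> the eigenvector equation becomes \<open>g i * w i = c * w i\<close> for all \<open>i\<close>,
  and some \<open>w i\<close> is nonzero.\<close>

lemma eigenvalue_of_diagonalized_matrix:
  fixes P Q M :: "complex mat"
  assumes P: "P \<in> carrier_mat n n" and Q: "Q \<in> carrier_mat n n"
    and PQ: "P * Q = 1\<^sub>m n" and QP: "Q * P = 1\<^sub>m n"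
    and M: "M = P * mat_diag n g * Q"
    and v: "v \<in> carrier_vec n" "v \<noteq> 0\<^sub>v n" and ev: "M *\<^sub>v v = c \<cdot>\<^sub>v v"
  shows "c \<in> g ` {0..<n}"
proof -
  define w where "w = Q *\<^sub>v v"
  have w: "w \<in> carrier_vec n" using Q v by (simp add: w_def)
  have "P *\<^sub>v w = (P * Q) *\<^sub>v v" using P Q v by (simp add: w_def)
  then have Pw: "P *\<^sub>v w = v" using PQ v by simp
  have "w \<noteq> 0\<^sub>v n" using Pw P v by auto
  then obtain i where i: "i < n" "w $ i \<noteq> 0" using w by (auto simp: vec_eq_iff)
  have D: "mat_diag n g *\<^sub>v w \<in> carrier_vec n"
    by (rule mult_mat_vec_carrier[OF mat_diag_dim w])
  have "mat_diag n g *\<^sub>v w = (Q * P) *\<^sub>v (mat_diag n g *\<^sub>v w)" using D QP by simp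
  also have "\<dots> = Q *\<^sub>v (P *\<^sub>v (mat_diag n g *\<^sub>v w))"
    by (rule assoc_mult_mat_vec[OF Q P D])
  also have "P *\<^sub>v (mat_diag n g *\<^sub>v w) = M *\<^sub>v v"
    unfolding M w_def using P Q v
    by (simp add: assoc_mult_mat_vec[where ?n\<^sub>1.0 = n and ?n\<^sub>2.0 = n and ?n\<^sub>3.0 = n])
  also have "Q *\<^sub>v (M *\<^sub>v v) = c \<cdot>\<^sub>v w"
    unfolding ev w_def using Q v by (simp add: mult_mat_vec)
  finally have "(mat_diag n g *\<^sub>v w) $ i = (c \<cdot>\<^sub>v w) $ i" by simp
  moreover have "(mat_diag n g *\<^sub>v w) $ i = g i * w $ i"
  proof -
    have "(mat_diag n g *\<^sub>v w) $ i = (\<Sum>j = 0..<n. (if i = j then g j else 0) * w $ j)"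
      using i w by (simp add: mat_diag_def scalar_prod_def)
    also have "\<dots> = (\<Sum>j = 0..<n. if j = i then g i * w $ i else 0)"
      by (intro sum.cong) auto
    finally have "(mat_diag n g *\<^sub>v w) $ i = (\<Sum>j = 0..<n. if j = i then g i * w $ i else 0)" .
    then show ?thesis using i by simp
  qed
  ultimately have "g i = c" using i w by simp
  then show ?thesis using i by auto
qed

section \<open>Diagonalization of the orbital operator\<close>

lemma character_nonzero:
  assumes "n \<ge> 1"
  shows "character n k \<noteq> 0\<^sub>v n"
proof
  assume "character n k = 0\<^sub>v n"
  then have "character n k $ 0 = 0\<^sub>v n $ 0" by simp
  then show False using assms by (simp add: character_def)
qed

text \<open>A character is well defined on residues, so the reduction of \<open>r + s\<close> modulo \<open>n\<close> can be dropped and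
  \<open>\<chi>\<^sub>k(r)\<close> factors out of the sum.\<close>

lemma orbital_op_character:
  assumes "n \<ge> 1"
  shows "orbital_op n A (character n k) = G n A k \<cdot>\<^sub>v character n k"
proof (rule eq_vecI)
  fix r assume "r < dim_vec (G n A k \<cdot>\<^sub>v character n k)"
  then have r: "r < n" by (simp add: character_def)
  have "orbital_op n A (character n k) $ r
      = (\<Sum>s = 0..<n. Lambda n A s * root_unity n ^ (k * ((r + s) mod n)))"
    using r by (simp add: orbital_op_def character_def)
  also have "\<dots> = (\<Sum>s = 0..<n. Lambda n A s * root_unity n ^ (k * s) * root_unity n ^ (k * r))"
    by (simp add: root_unity_power_mod[OF assms] distrib_left power_add mult_ac)
  also have "\<dots> = G n A k * root_unity n ^ (k * r)"
    by (simp add: G_def sum_distrib_right)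
  finally show "orbital_op n A (character n k) $ r = (G n A k \<cdot>\<^sub>v character n k) $ r"
    using r by (simp add: character_def)
qed (simp add: orbital_op_def character_def)

lemma orbital_op_eigenvector_character:
  assumes "n \<ge> 1"
  shows "op_eigenvector n (orbital_op n A) (character n k) (G n A k)"
  unfolding op_eigenvector_def
  using character_nonzero[OF assms] orbital_op_character[OF assms]
  by (simp add: character_def)

lemma character_basis:
  assumes "n \<ge> 1"
  shows "inj_on (character n) {0..<n}" and "is_basis n (character n ` {0..<n})"
proof -
  let ?s = "complex_of_real (sqrt (real n))"
  let ?P = "?s \<cdot>\<^sub>m dft_mat n" and ?Q = "(1 / ?s) \<cdot>\<^sub>m dft_inv_mat n"
  have s: "?s \<noteq> 0" using assms by simp
  have P: "?P \<in> carrier_mat n n" and Q: "?Q \<in> carrier_mat n n" by simp_all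
  have QP: "?Q * ?P = 1\<^sub>m n"
    using s dft_mat_inverse(2)[OF assms]
    by (simp add: mult_smult_distrib[where nr = n and n = n and nc = n]
        mult_smult_assoc_mat[where nr = n and n = n and nc = n])
      (auto intro!: eq_matI)
  have "col ?P k = character n k" if "k < n" for k
    using that s by (intro eq_vecI) (auto simp: dft_mat_def character_def mult.commute)
  then have cols: "cols ?P = map (character n) [0..<n]"
    by (auto simp: cols_def dft_mat_def)
  show "inj_on (character n) {0..<n}"
    using cols_basis_of_left_inverse(1)[OF P Q QP] unfolding cols by (simp add: distinct_map)
  show "is_basis n (character n ` {0..<n})"
    using cols_basis_of_left_inverse(2)[OF P Q QP] unfolding cols by simp
qed

lemma std_matrix_orbital_op_diagonalization:
  assumes "n \<ge> 1"
  shows "std_matrix n (orbital_op n A) = dft_mat n * mat_diag n (G n A) * dft_inv_mat n"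
proof -
  let ?H = "std_matrix n (orbital_op n A)" and ?F = "dft_mat n" and ?D = "mat_diag n (G n A)"
  let ?c = "1 / complex_of_real (sqrt (real n))"
  have H: "?H \<in> carrier_mat n n" by (simp add: std_matrix_def)
  have chi: "character n k \<in> carrier_vec n" for k by (simp add: character_def)
  \<comment> \<open>Column \<open>k\<close> of this identity is the eigenvector equation of \<open>\<chi>\<^sub>k\<close>, divided by \<open>\<surd>n\<close>.\<close>
  have HF: "?H * ?F = ?F * ?D"
  proof (rule mat_col_eqI)
    fix k assume "k < dim_col (?F * ?D)"
    then have k: "k < n" by (simp add: mat_diag_def)
    have F_col: "col ?F k = ?c \<cdot>\<^sub>v character n k"
      using k by (intro eq_vecI) (auto simp: dft_mat_def character_def mult.commute)
    have "col (?H * ?F) k = ?H *\<^sub>v col ?F k"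
      using k by (intro col_mult2[OF H]) simp_all
    also have "\<dots> = ?c \<cdot>\<^sub>v (?H *\<^sub>v character n k)"
      unfolding F_col by (rule mult_mat_vec[OF H chi])
    also have "\<dots> = ?c \<cdot>\<^sub>v (G n A k \<cdot>\<^sub>v character n k)"
      by (simp only: std_matrix_orbital_op[OF chi, symmetric] orbital_op_character[OF assms])
    also have "\<dots> = col (?F * ?D) k"
      unfolding mat_diag_mult_right[OF dft_mat_carrier]
      using k by (intro eq_vecI) (auto simp: dft_mat_def character_def mult_ac)
    finally show "col (?H * ?F) k = col (?F * ?D) k" .
  qed (simp_all add: std_matrix_def dft_mat_def mat_diag_def)
  have "?H = ?H * (?F * dft_inv_mat n)" using H dft_mat_inverse(1)[OF assms] by simp
  also have "\<dots> = ?H * ?F * dft_inv_mat n"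
    by (rule assoc_mult_mat[OF H dft_mat_carrier dft_inv_mat_carrier, symmetric])
  finally show ?thesis unfolding HF .
qed

lemma orbital_op_eigenvalues:
  assumes "n \<ge> 1"
  shows "{c. \<exists>v. op_eigenvector n (orbital_op n A) v c} = G n A ` {0..<n}"
proof (intro equalityI subsetI)
  fix c assume "c \<in> {c. \<exists>v. op_eigenvector n (orbital_op n A) v c}"
  then obtain v where v: "v \<in> carrier_vec n" "v \<noteq> 0\<^sub>v n" "orbital_op n A v = c \<cdot>\<^sub>v v"
    by (auto simp: op_eigenvector_def)
  have "std_matrix n (orbital_op n A) *\<^sub>v v = c \<cdot>\<^sub>v v"
    using v std_matrix_orbital_op by metis
  then show "c \<in> G n A ` {0..<n}"
    by (rule eigenvalue_of_diagonalized_matrix[OF dft_mat_carrier dft_inv_mat_carrier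
        dft_mat_inverse[OF assms] std_matrix_orbital_op_diagonalization[OF assms] v(1,2)])
next
  fix c assume "c \<in> G n A ` {0..<n}"
  then show "c \<in> {c. \<exists>v. op_eigenvector n (orbital_op n A) v c}"
    using orbital_op_eigenvector_character[OF assms] by auto
qed

theorem theorem6p5:
  fixes n :: nat and A :: "complex mat"
  assumes "n \<ge> 1" and "A \<in> carrier_mat n n"
  shows "inj_on (character n) {0..<n}
    \<and> is_basis n (character n ` {0..<n})
    \<and> (\<forall>k<n. op_eigenvector n (orbital_op n A) (character n k) (G n A k))
    \<and> {c. \<exists>v. op_eigenvector n (orbital_op n A) v c} = G n A ` {0..<n}
    \<and> op_diagonalizable n (orbital_op n A)
    \<and> (\<exists>F_inv \<in> carrier_mat n n. inverts_mat (dft_mat n) F_inv \<and> inverts_mat F_inv (dft_mat n)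
         \<and> std_matrix n (orbital_op n A) = dft_mat n * mat_diag n (G n A) * F_inv)"
proof (intro conjI)
  show "inj_on (character n) {0..<n}" and basis: "is_basis n (character n ` {0..<n})"
    using character_basis[OF assms(1)] by simp_all
  show "\<forall>k<n. op_eigenvector n (orbital_op n A) (character n k) (G n A k)"
    using orbital_op_eigenvector_character[OF assms(1)] by simp
  show "{c. \<exists>v. op_eigenvector n (orbital_op n A) v c} = G n A ` {0..<n}"
    by (rule orbital_op_eigenvalues[OF assms(1)])
  show "op_diagonalizable n (orbital_op n A)"
    unfolding op_diagonalizable_def
    using basis orbital_op_eigenvector_character[OF assms(1)] by blast
  show "\<exists>F_inv \<in> carrier_mat n n. inverts_mat (dft_mat n) F_inv \<and> inverts_mat F_inv (dft_mat n)
      \<and> std_matrix n (orbital_op n A) = dft_mat n * mat_diag n (G n A) * F_inv"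
    using dft_mat_inverse[OF assms(1)] std_matrix_orbital_op_diagonalization[OF assms(1)]
    by (intro bexI[of _ "dft_inv_mat n"])
      (simp_all add: inverts_mat_def dft_mat_def dft_inv_mat_def)
qed

end
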